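(* Let $N, N_1, N_2$ be terms, $\varepsilon\in{\cal E}$ and $\overline{V}$ a sequence of elements of ${\cal E}$ such that the sequence $\varepsilon\ \overline{V}$ is nice, and such that the terms below are typed. If $S_2=(N\ [x_1.(N_1\ \varepsilon),x_2.(N_2\ \varepsilon)]\ \overline{V})\in SN$, then $S_1=(N\ [x_1.N_1,x_2.N_2]\ \varepsilon\ \overline{V})\in SN$.
   Context: Formulas: atoms, $\perp$, $\rightarrow,\wedge,\vee$; $\neg A=A\rightarrow\perp$. Intuitionistic variables $x,y,\dots$, classical variables $a,b,\dots$. Terms: ${\cal T} ::= x \mid \lambda x\, {\cal T} \mid ({\cal T}\ {\cal E}) \mid \langle {\cal T},{\cal T}\rangle \mid \omega_1 {\cal T} \mid \omega_2 {\cal T} \mid \mu a\, {\cal T} \mid (a\ {\cal T})$, ${\cal E} ::= {\cal T} \mid \pi_1 \mid \pi_2 \mid [x.{\cal T}, y.{\cal T}]$; $(M\ E_1\dots E_n)=((M\ E_1)\dots E_n)$. Typing (contexts contain $x:A$, $a:\neg A$): $x:A$ for declared $x$; $\langle M,N\rangle:A\wedge B$ from $M:A,N:B$; $(M\ \pi_i):A_i$ from $M:A_1\wedge A_2$; $\lambda xM:A\rightarrow B$ from $M:B$ under $x:A$; $(M\ N):B$ from $M:A\rightarrow B,N:A$; $\omega_iM:A_1\vee A_2$ from $M:A_i$; $(M\ [x_1.N_1,x_2.N_2]):C$ from $M:A_1\vee A_2$ and $N_i:C$ under $x_i:A_i$; $\mu aM:A$ from $M:\perp$ under $a:\neg A$;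 $(a\ M):\perp$ from $M:A$ under $a:\neg A$. Typed = has a type in some context. Reduction $\triangleright$: compatible closure of $(\lambda x M\ N)\triangleright M[x:=N]$; $(\langle M_1,M_2\rangle\ \pi_i)\triangleright M_i$; $(\omega_i M\ [x_1.N_1,x_2.N_2])\triangleright N_i[x_i:=M]$; $(M\ [x_1.N_1,x_2.N_2]\ \varepsilon)\triangleright (M\ [x_1.(N_1\ \varepsilon),x_2.(N_2\ \varepsilon)])$; $(\mu a M\ \varepsilon)\triangleright \mu a\, M[a:=^*\varepsilon]$ ($M[a:=^*\varepsilon]$ replaces each subterm $(a\ P)$ by $(a\ (P\ \varepsilon))$). $SN$: no infinite reduction sequence. A (possibly empty) sequence $E_1,\dots,E_n$ of elements of ${\cal E}$ is nice if each $E_i\in{\cal T}\cup\{\pi_1,\pi_2\}$ except possibly $E_n$. *)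

theory Defs
  imports Main
begin

datatype form =
    Atom nat
  | Bot
  | Imp form form
  | And form form
  | Or form form

(* Terms are taken up to renaming of bound variables, using de Bruijn indices.  Intuitionistic
   and classical variables are numbered independently of each other: Lam binds the intuitionistic
   index 0, each branch of Case binds its own intuitionistic index 0, and Mu binds the classical
   index 0.  CVar a M is the term (a M). *)
datatype trm =
    Var nat
  | Lam trm
  | App trm elim
  | Pair trm trm
  | Inj1 trm
  | Inj2 trm
  | Mu trm
  | CVar nat trm
and elim =
    Arg trm
  | Proj1
  | Proj2
  | Case trm trm

definition apps :: "trm \<Rightarrow> elim list \<Rightarrow> trm" where
  "apps M Es = foldl App M Es"

(* In a judgement \<Gamma>; \<Delta> \<turnstile> M : A, an entry B at position i of \<Gamma> is the declaration x_i : B, whereas an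
   entry B at position i of \<Delta> is the declaration a_i : \<not>B. *)
inductive typing :: "form list \<Rightarrow> form list \<Rightarrow> trm \<Rightarrow> form \<Rightarrow> bool"
  ("_; _ \<turnstile> _ : _" [50, 50, 50, 50] 50) where
  ty_var: "i < length \<Gamma> \<Longrightarrow> \<Gamma>; \<Delta> \<turnstile> Var i : \<Gamma> ! i"
| ty_pair: "\<Gamma>; \<Delta> \<turnstile> M : A \<Longrightarrow> \<Gamma>; \<Delta> \<turnstile> N : B \<Longrightarrow> \<Gamma>; \<Delta> \<turnstile> Pair M N : And A B"
| ty_proj1: "\<Gamma>; \<Delta> \<turnstile> M : And A B \<Longrightarrow> \<Gamma>; \<Delta> \<turnstile> App M Proj1 : A"
| ty_proj2: "\<Gamma>; \<Delta> \<turnstile> M : And A B \<Longrightarrow> \<Gamma>; \<Delta> \<turnstile> App M Proj2 : B"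
| ty_lam: "A # \<Gamma>; \<Delta> \<turnstile> M : B \<Longrightarrow> \<Gamma>; \<Delta> \<turnstile> Lam M : Imp A B"
| ty_app: "\<Gamma>; \<Delta> \<turnstile> M : Imp A B \<Longrightarrow> \<Gamma>; \<Delta> \<turnstile> N : A \<Longrightarrow> \<Gamma>; \<Delta> \<turnstile> App M (Arg N) : B"
| ty_inj1: "\<Gamma>; \<Delta> \<turnstile> M : A \<Longrightarrow> \<Gamma>; \<Delta> \<turnstile> Inj1 M : Or A B"
| ty_inj2: "\<Gamma>; \<Delta> \<turnstile> M : B \<Longrightarrow> \<Gamma>; \<Delta> \<turnstile> Inj2 M : Or A B"
| ty_case: "\<Gamma>; \<Delta> \<turnstile> M : Or A B \<Longrightarrow> A # \<Gamma>; \<Delta> \<turnstile> N1 : C \<Longrightarrow> B # \<Gamma>; \<Delta> \<turnstile> N2 : C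
    \<Longrightarrow> \<Gamma>; \<Delta> \<turnstile> App M (Case N1 N2) : C"
| ty_mu: "\<Gamma>; A # \<Delta> \<turnstile> M : Bot \<Longrightarrow> \<Gamma>; \<Delta> \<turnstile> Mu M : A"
| ty_cvar: "a < length \<Delta> \<Longrightarrow> \<Gamma>; \<Delta> \<turnstile> M : \<Delta> ! a \<Longrightarrow> \<Gamma>; \<Delta> \<turnstile> CVar a M : Bot"

definition typed :: "trm \<Rightarrow> bool" where
  "typed M \<longleftrightarrow> (\<exists>\<Gamma> \<Delta> A. \<Gamma>; \<Delta> \<turnstile> M : A)"

(* Shift the free intuitionistic indices \<ge> k by one. *)
primrec lift :: "nat \<Rightarrow> trm \<Rightarrow> trm" and liftE :: "nat \<Rightarrow> elim \<Rightarrow> elim" where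
  "lift k (Var i) = Var (if i < k then i else Suc i)"
| "lift k (Lam M) = Lam (lift (Suc k) M)"
| "lift k (App M E) = App (lift k M) (liftE k E)"
| "lift k (Pair M N) = Pair (lift k M) (lift k N)"
| "lift k (Inj1 M) = Inj1 (lift k M)"
| "lift k (Inj2 M) = Inj2 (lift k M)"
| "lift k (Mu M) = Mu (lift k M)"
| "lift k (CVar a M) = CVar a (lift k M)"
| "liftE k (Arg M) = Arg (lift k M)"
| "liftE k Proj1 = Proj1"
| "liftE k Proj2 = Proj2"
| "liftE k (Case M N) = Case (lift (Suc k) M) (lift (Suc k) N)"

(* Shift the free classical indices \<ge> k by one. *)
primrec clift :: "nat \<Rightarrow> trm \<Rightarrow> trm" and cliftE :: "nat \<Rightarrow> elim \<Rightarrow> elim" where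
  "clift k (Var i) = Var i"
| "clift k (Lam M) = Lam (clift k M)"
| "clift k (App M E) = App (clift k M) (cliftE k E)"
| "clift k (Pair M N) = Pair (clift k M) (clift k N)"
| "clift k (Inj1 M) = Inj1 (clift k M)"
| "clift k (Inj2 M) = Inj2 (clift k M)"
| "clift k (Mu M) = Mu (clift (Suc k) M)"
| "clift k (CVar a M) = CVar (if a < k then a else Suc a) (clift k M)"
| "cliftE k (Arg M) = Arg (clift k M)"
| "cliftE k Proj1 = Proj1"
| "cliftE k Proj2 = Proj2"
| "cliftE k (Case M N) = Case (clift k M) (clift k N)"

(* subst M P k is M[x_k := P]; the binder of x_k disappears, so the larger indices drop by one. *)
primrec subst :: "trm \<Rightarrow> trm \<Rightarrow> nat \<Rightarrow> trm" and substE :: "elim \<Rightarrow> trm \<Rightarrow> nat \<Rightarrow> elim" where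
  "subst (Var i) P k = (if i < k then Var i else if i = k then P else Var (i - 1))"
| "subst (Lam M) P k = Lam (subst M (lift 0 P) (Suc k))"
| "subst (App M E) P k = App (subst M P k) (substE E P k)"
| "subst (Pair M N) P k = Pair (subst M P k) (subst N P k)"
| "subst (Inj1 M) P k = Inj1 (subst M P k)"
| "subst (Inj2 M) P k = Inj2 (subst M P k)"
| "subst (Mu M) P k = Mu (subst M (clift 0 P) k)"
| "subst (CVar a M) P k = CVar a (subst M P k)"
| "substE (Arg M) P k = Arg (subst M P k)"
| "substE Proj1 P k = Proj1"
| "substE Proj2 P k = Proj2"
| "substE (Case M N) P k = Case (subst M (lift 0 P) (Suc k)) (subst N (lift 0 P) (Suc k))"

(* csubst M F k is M[a_k :=* F].  The variable a_k stays, so no index drops. *)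
primrec csubst :: "trm \<Rightarrow> elim \<Rightarrow> nat \<Rightarrow> trm" and csubstE :: "elim \<Rightarrow> elim \<Rightarrow> nat \<Rightarrow> elim" where
  "csubst (Var i) F k = Var i"
| "csubst (Lam M) F k = Lam (csubst M (liftE 0 F) k)"
| "csubst (App M E) F k = App (csubst M F k) (csubstE E F k)"
| "csubst (Pair M N) F k = Pair (csubst M F k) (csubst N F k)"
| "csubst (Inj1 M) F k = Inj1 (csubst M F k)"
| "csubst (Inj2 M) F k = Inj2 (csubst M F k)"
| "csubst (Mu M) F k = Mu (csubst M (cliftE 0 F) (Suc k))"
| "csubst (CVar a M) F k =
     (if a = k then CVar a (App (csubst M F k) F) else CVar a (csubst M F k))"
| "csubstE (Arg M) F k = Arg (csubst M F k)"
| "csubstE Proj1 F k = Proj1"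
| "csubstE Proj2 F k = Proj2"
| "csubstE (Case M N) F k = Case (csubst M (liftE 0 F) k) (csubst N (liftE 0 F) k)"

inductive red :: "trm \<Rightarrow> trm \<Rightarrow> bool" (infix "\<rhd>" 50)
  and redE :: "elim \<Rightarrow> elim \<Rightarrow> bool" (infix "\<rhd>\<^sub>E" 50) where
  beta: "App (Lam M) (Arg N) \<rhd> subst M N 0"
| proj1: "App (Pair M1 M2) Proj1 \<rhd> M1"
| proj2: "App (Pair M1 M2) Proj2 \<rhd> M2"
| case1: "App (Inj1 M) (Case N1 N2) \<rhd> subst N1 M 0"
| case2: "App (Inj2 M) (Case N1 N2) \<rhd> subst N2 M 0"
| perm: "App (App M (Case N1 N2)) E \<rhd> App M (Case (App N1 (liftE 0 E)) (App N2 (liftE 0 E)))"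
| mu: "App (Mu M) E \<rhd> Mu (csubst M (cliftE 0 E) 0)"
| lam: "M \<rhd> M' \<Longrightarrow> Lam M \<rhd> Lam M'"
| appL: "M \<rhd> M' \<Longrightarrow> App M E \<rhd> App M' E"
| appR: "E \<rhd>\<^sub>E E' \<Longrightarrow> App M E \<rhd> App M E'"
| pairL: "M \<rhd> M' \<Longrightarrow> Pair M N \<rhd> Pair M' N"
| pairR: "N \<rhd> N' \<Longrightarrow> Pair M N \<rhd> Pair M N'"
| inj1: "M \<rhd> M' \<Longrightarrow> Inj1 M \<rhd> Inj1 M'"
| inj2: "M \<rhd> M' \<Longrightarrow> Inj2 M \<rhd> Inj2 M'"
| muC: "M \<rhd> M' \<Longrightarrow> Mu M \<rhd> Mu M'"
| cvar: "M \<rhd> M' \<Longrightarrow> CVar a M \<rhd> CVar a M'"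
| arg: "M \<rhd> M' \<Longrightarrow> Arg M \<rhd>\<^sub>E Arg M'"
| caseL: "M \<rhd> M' \<Longrightarrow> Case M N \<rhd>\<^sub>E Case M' N"
| caseR: "N \<rhd> N' \<Longrightarrow> Case M N \<rhd>\<^sub>E Case M N'"

definition SN :: "trm set" where
  "SN = {M. \<nexists>f. f 0 = M \<and> (\<forall>n. f n \<rhd> f (Suc n))}"

definition nice :: "elim list \<Rightarrow> bool" where
  "nice Es \<longleftrightarrow> (\<forall>E \<in> set (butlast Es). E \<in> range Arg \<union> {Proj1, Proj2})"

end

theory Submission
  imports Defs
begin

text \<open>All typed terms are strongly normalizing, by an orthogonality argument: each formula \<open>A\<close> gets a set \<open>stk A\<close> of stacks of
  eliminations, and its candidate consists of the terms that are in \<open>SN\<close> against all these stacks.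
  A stack for \<open>Or A B\<close> is a case elimination followed by an arbitrary rest \<open>S\<close> such that both branches,
  instantiated by elements of the candidates, are in \<open>SN\<close> against the same \<open>S\<close>.  A permutation only
  moves the head of \<open>S\<close> into the branches and leaves the tested terms unchanged, so it is controlled by
  the length of the stack, and no separate theorem about permutations is needed.  Classical variables
  are interpreted by whole stacks.\<close>

subsection \<open>Parallel renaming and substitution\<close>

definition upr :: "(nat \<Rightarrow> nat) \<Rightarrow> nat \<Rightarrow> nat" where
  "upr r = case_nat 0 (\<lambda>i. Suc (r i))"

primrec ren :: "(nat \<Rightarrow> nat) \<Rightarrow> (nat \<Rightarrow> nat) \<Rightarrow> trm \<Rightarrow> trm"
  and renE :: "(nat \<Rightarrow> nat) \<Rightarrow> (nat \<Rightarrow> nat) \<Rightarrow> elim \<Rightarrow> elim" where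
  "ren r s (Var i) = Var (r i)"
| "ren r s (Lam M) = Lam (ren (upr r) s M)"
| "ren r s (App M E) = App (ren r s M) (renE r s E)"
| "ren r s (Pair M N) = Pair (ren r s M) (ren r s N)"
| "ren r s (Inj1 M) = Inj1 (ren r s M)"
| "ren r s (Inj2 M) = Inj2 (ren r s M)"
| "ren r s (Mu M) = Mu (ren r (upr s) M)"
| "ren r s (CVar a M) = CVar (s a) (ren r s M)"
| "renE r s (Arg M) = Arg (ren r s M)"
| "renE r s Proj1 = Proj1"
| "renE r s Proj2 = Proj2"
| "renE r s (Case M N) = Case (ren (upr r) s M) (ren (upr r) s N)"

definition upi :: "(nat \<Rightarrow> trm) \<Rightarrow> nat \<Rightarrow> trm" where
  "upi \<sigma> = case_nat (Var 0) (\<lambda>i. ren Suc id (\<sigma> i))"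

text \<open>A freshly bound classical variable receives the empty stack, so its occurrences stay as
  they are.\<close>

definition upc :: "(nat \<Rightarrow> elim list) \<Rightarrow> nat \<Rightarrow> elim list" where
  "upc \<tau> = case_nat [] (\<lambda>a. map (renE id Suc) (\<tau> a))"

text \<open>Combines intuitionistic substitution, renaming of classical variables and a generalized
  \<open>csubst\<close> that appends a whole stack to the argument of each \<open>(a M)\<close>.
  Stacks instead of single eliminations make these substitutions closed under composition.\<close>

primrec psub :: "(nat \<Rightarrow> trm) \<Rightarrow> (nat \<Rightarrow> nat) \<Rightarrow> (nat \<Rightarrow> elim list) \<Rightarrow> trm \<Rightarrow> trm"
  and psubE :: "(nat \<Rightarrow> trm) \<Rightarrow> (nat \<Rightarrow> nat) \<Rightarrow> (nat \<Rightarrow> elim list) \<Rightarrow> elim \<Rightarrow> elim" where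
  "psub \<sigma> \<rho> \<tau> (Var i) = \<sigma> i"
| "psub \<sigma> \<rho> \<tau> (Lam M) = Lam (psub (upi \<sigma>) \<rho> (map (renE Suc id) \<circ> \<tau>) M)"
| "psub \<sigma> \<rho> \<tau> (App M E) = App (psub \<sigma> \<rho> \<tau> M) (psubE \<sigma> \<rho> \<tau> E)"
| "psub \<sigma> \<rho> \<tau> (Pair M N) = Pair (psub \<sigma> \<rho> \<tau> M) (psub \<sigma> \<rho> \<tau> N)"
| "psub \<sigma> \<rho> \<tau> (Inj1 M) = Inj1 (psub \<sigma> \<rho> \<tau> M)"
| "psub \<sigma> \<rho> \<tau> (Inj2 M) = Inj2 (psub \<sigma> \<rho> \<tau> M)"
| "psub \<sigma> \<rho> \<tau> (Mu M) = Mu (psub (ren id Suc \<circ> \<sigma>) (upr \<rho>) (upc \<tau>) M)"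
| "psub \<sigma> \<rho> \<tau> (CVar a M) = CVar (\<rho> a) (apps (psub \<sigma> \<rho> \<tau> M) (\<tau> a))"
| "psubE \<sigma> \<rho> \<tau> (Arg M) = Arg (psub \<sigma> \<rho> \<tau> M)"
| "psubE \<sigma> \<rho> \<tau> Proj1 = Proj1"
| "psubE \<sigma> \<rho> \<tau> Proj2 = Proj2"
| "psubE \<sigma> \<rho> \<tau> (Case M N) =
     Case (psub (upi \<sigma>) \<rho> (map (renE Suc id) \<circ> \<tau>) M) (psub (upi \<sigma>) \<rho> (map (renE Suc id) \<circ> \<tau>) N)"

section \<open>Composition laws for renaming and substitution\<close>

lemma apps_simps [simp]:
  "apps M [] = M" "apps M (E # Es) = apps (App M E) Es"
  by (simp_all add: apps_def)

lemma apps_append [simp]: "apps M (S @ S') = apps (apps M S) S'"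
  by (simp add: apps_def)

lemma ren_apps [simp]: "ren r s (apps M S) = apps (ren r s M) (map (renE r s) S)"
  by (induction S arbitrary: M) auto

lemma psub_apps [simp]: "psub \<sigma> \<rho> \<tau> (apps M S) = apps (psub \<sigma> \<rho> \<tau> M) (map (psubE \<sigma> \<rho> \<tau>) S)"
  by (induction S arbitrary: M) auto

lemma upr_comp: "upr r \<circ> upr r' = upr (r \<circ> r')"
  by (auto simp: upr_def fun_eq_iff split: nat.split)

lemma upr_id: "upr id = id"
  by (auto simp: upr_def fun_eq_iff split: nat.split)

lemma upr_Suc: "upr r \<circ> Suc = Suc \<circ> r"
  by (auto simp: upr_def)

lemma ren_ren:
  "ren r s (ren r' s' M) = ren (r \<circ> r') (s \<circ> s') M"
  "renE r s (renE r' s' E) = renE (r \<circ> r') (s \<circ> s') E"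
  by (induction M and E arbitrary: r s r' s' and r s r' s' rule: trm.induct elim.induct)
    (auto simp: upr_comp)

lemma upi_upr: "upi \<sigma> \<circ> upr r = upi (\<sigma> \<circ> r)"
  by (auto simp: upr_def upi_def fun_eq_iff split: nat.split)

lemma upc_upr: "upc \<tau> \<circ> upr r = upc (\<tau> \<circ> r)"
  by (auto simp: upr_def upc_def fun_eq_iff split: nat.split)

lemma psub_ren:
  "psub \<sigma> \<rho> \<tau> (ren r s M) = psub (\<sigma> \<circ> r) (\<rho> \<circ> s) (\<tau> \<circ> s) M"
  "psubE \<sigma> \<rho> \<tau> (renE r s E) = psubE (\<sigma> \<circ> r) (\<rho> \<circ> s) (\<tau> \<circ> s) E"
  by (induction M and E arbitrary: \<sigma> \<rho> \<tau> r s and \<sigma> \<rho> \<tau> r s rule: trm.induct elim.induct)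
    (auto simp: upr_comp upi_upr upc_upr comp_assoc)

lemma ren_upi: "ren (upr r) s \<circ> upi \<sigma> = upi (ren r s \<circ> \<sigma>)"
  by (auto simp: upi_def fun_eq_iff ren_ren upr_Suc split: nat.split) (auto simp: upr_def)

lemma ren_upc: "map (renE r (upr s)) \<circ> upc \<tau> = upc (map (renE r s) \<circ> \<tau>)"
  by (auto simp: upc_def fun_eq_iff ren_ren upr_Suc split: nat.split)

lemma ren_shift:
  "map (renE (upr r) s) \<circ> (map (renE Suc id) \<circ> \<tau>) = map (renE Suc id) \<circ> (map (renE r s) \<circ> \<tau>)"
  "ren r (upr s) \<circ> (ren id Suc \<circ> \<sigma>) = ren id Suc \<circ> (ren r s \<circ> \<sigma>)"
  by (auto simp: fun_eq_iff ren_ren upr_Suc)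

lemma ren_psub:
  "ren r s (psub \<sigma> \<rho> \<tau> M) = psub (ren r s \<circ> \<sigma>) (s \<circ> \<rho>) (map (renE r s) \<circ> \<tau>) M"
  "renE r s (psubE \<sigma> \<rho> \<tau> E) = psubE (ren r s \<circ> \<sigma>) (s \<circ> \<rho>) (map (renE r s) \<circ> \<tau>) E"
  by (induction M and E arbitrary: \<sigma> \<rho> \<tau> r s and \<sigma> \<rho> \<tau> r s rule: trm.induct elim.induct)
    (simp_all add: ren_upi upr_comp ren_upc ren_shift)

lemma psub_upi:
  "psub (upi \<sigma>') \<rho>' (map (renE Suc id) \<circ> \<tau>') \<circ> upi \<sigma> = upi (psub \<sigma>' \<rho>' \<tau>' \<circ> \<sigma>)"
  by (auto simp: upi_def fun_eq_iff ren_psub psub_ren comp_def split: nat.split)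

lemma psub_upi_stack:
  "(\<lambda>a. map (psubE (upi \<sigma>') \<rho>' (map (renE Suc id) \<circ> \<tau>')) ((map (renE Suc id) \<circ> \<tau>) a)
      @ (map (renE Suc id) \<circ> \<tau>') (\<rho> a))
    = map (renE Suc id) \<circ> (\<lambda>a. map (psubE \<sigma>' \<rho>' \<tau>') (\<tau> a) @ \<tau>' (\<rho> a))"
  by (auto simp: upi_def fun_eq_iff ren_psub psub_ren comp_def)

lemma psub_upc:
  "psub (ren id Suc \<circ> \<sigma>') (upr \<rho>') (upc \<tau>') \<circ> (ren id Suc \<circ> \<sigma>)
     = ren id Suc \<circ> (psub \<sigma>' \<rho>' \<tau>' \<circ> \<sigma>)"
  by (auto simp: upr_def upc_def fun_eq_iff ren_psub psub_ren comp_def)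

lemma psub_upc_stack:
  "(\<lambda>a. map (psubE (ren id Suc \<circ> \<sigma>') (upr \<rho>') (upc \<tau>')) (upc \<tau> a) @ upc \<tau>' (upr \<rho> a))
    = upc (\<lambda>a. map (psubE \<sigma>' \<rho>' \<tau>') (\<tau> a) @ \<tau>' (\<rho> a))"
  by (auto simp: upr_def upc_def fun_eq_iff ren_psub psub_ren comp_def split: nat.split)

text \<open>The first substitution renames the occurrence to \<open>\<rho> a\<close> and appends
  \<open>\<tau> a\<close>; the second one then acts on the entries of \<open>\<tau> a\<close> and
  appends its own stack for \<open>\<rho> a\<close>.\<close>

lemma psub_psub:
  "psub \<sigma>' \<rho>' \<tau>' (psub \<sigma> \<rho> \<tau> M) = psub (psub \<sigma>' \<rho>' \<tau>' \<circ> \<sigma>) (\<rho>' \<circ> \<rho>)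
     (\<lambda>a. map (psubE \<sigma>' \<rho>' \<tau>') (\<tau> a) @ \<tau>' (\<rho> a)) M"
  "psubE \<sigma>' \<rho>' \<tau>' (psubE \<sigma> \<rho> \<tau> E) = psubE (psub \<sigma>' \<rho>' \<tau>' \<circ> \<sigma>) (\<rho>' \<circ> \<rho>)
     (\<lambda>a. map (psubE \<sigma>' \<rho>' \<tau>') (\<tau> a) @ \<tau>' (\<rho> a)) E"
  \<comment> \<open>\<open>comp_apply\<close> is held back at first so that the composed arguments
    keep the shape in which the lemmas on \<open>upi\<close> and \<open>upc\<close> are
    stated.\<close>
  by (induction M and E arbitrary: \<sigma> \<rho> \<tau> \<sigma>' \<rho>' \<tau>' and \<sigma> \<rho> \<tau> \<sigma>' \<rho>' \<tau>' rule: trm.induct elim.induct)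
    (simp_all add: psub_upi psub_upc upr_comp psub_upi_stack psub_upc_stack del: comp_apply, simp_all)

lemma upi_Var: "upi Var = Var"
  by (auto simp: upi_def fun_eq_iff split: nat.split)

lemma ren_comp_Var: "ren r s \<circ> Var = Var \<circ> r"
  by (auto simp: fun_eq_iff)

lemma map_comp_Nil: "map f \<circ> (\<lambda>_. []) = (\<lambda>_. [])"
  by auto

lemma upc_Nil: "upc (\<lambda>_. []) = (\<lambda>_. [])"
  by (auto simp: upc_def fun_eq_iff split: nat.split)

lemma psub_id [simp]:
  "psub Var id (\<lambda>_. []) M = M"
  "psubE Var id (\<lambda>_. []) E = E"
  by (induction M and E rule: trm.induct elim.induct)
    (simp_all add: upi_Var upr_id upr_id[unfolded id_def] upc_Nil map_comp_Nil ren_comp_Var)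

lemmas psub_id' [simp] = psub_id[unfolded id_def]

section \<open>The single-variable operations as parallel substitutions\<close>

lemma ren_conv_psub:
  "ren r s M = psub (Var \<circ> r) s (\<lambda>_. []) M"
  "renE r s E = psubE (Var \<circ> r) s (\<lambda>_. []) E"
  using psub_ren(1)[of Var id "\<lambda>_. []" r s M] psub_ren(2)[of Var id "\<lambda>_. []" r s E]
  by (simp_all add: psub_id comp_def)

text \<open>The threshold \<open>k\<close> is generalized, since extending the shift at
  \<open>k\<close> under a binder yields the shift at \<open>Suc k\<close>.\<close>

lemma lift_conv_ren:
  "lift k M = ren (\<lambda>i. if i < k then i else Suc i) id M"
  "liftE k E = renE (\<lambda>i. if i < k then i else Suc i) id E"
proof -
  have *: "upr (\<lambda>i. if i < k then i else Suc i) = (\<lambda>i. if i < Suc k then i else Suc i)" for k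
    by (auto simp: upr_def fun_eq_iff split: nat.split)
  show "lift k M = ren (\<lambda>i. if i < k then i else Suc i) id M"
    "liftE k E = renE (\<lambda>i. if i < k then i else Suc i) id E"
    by (induction M and E arbitrary: k and k rule: trm.induct elim.induct) (simp_all add: * upr_id)
qed

lemma clift_conv_ren:
  "clift k M = ren id (\<lambda>i. if i < k then i else Suc i) M"
  "cliftE k E = renE id (\<lambda>i. if i < k then i else Suc i) E"
proof -
  have *: "upr (\<lambda>i. if i < k then i else Suc i) = (\<lambda>i. if i < Suc k then i else Suc i)" for k
    by (auto simp: upr_def fun_eq_iff split: nat.split)
  show "clift k M = ren id (\<lambda>i. if i < k then i else Suc i) M"
    "cliftE k E = renE id (\<lambda>i. if i < k then i else Suc i) E"
    by (induction M and E arbitrary: k and k rule: trm.induct elim.induct) (simp_all add: * upr_id)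
qed

lemma lift0: "lift 0 = ren Suc id" "liftE 0 = renE Suc id"
  by (simp_all add: lift_conv_ren fun_eq_iff)

lemma clift0: "clift 0 = ren id Suc" "cliftE 0 = renE id Suc"
  by (simp_all add: clift_conv_ren fun_eq_iff)

lemma subst_conv_psub_gen:
  "subst M P k = psub (\<lambda>i. if i < k then Var i else if i = k then P else Var (i - 1)) id (\<lambda>_. []) M"
  "substE E P k = psubE (\<lambda>i. if i < k then Var i else if i = k then P else Var (i - 1)) id (\<lambda>_. []) E"
proof -
  have *: "upi (\<lambda>i. if i < k then Var i else if i = k then P else Var (i - 1))
      = (\<lambda>i. if i < Suc k then Var i else if i = Suc k then ren Suc id P else Var (i - 1))" for k P
    by (auto simp: upi_def fun_eq_iff split: nat.split)
  have **: "ren id Suc \<circ> (\<lambda>i. if i < k then Var i else if i = k then P else Var (i - 1))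
      = (\<lambda>i. if i < k then Var i else if i = k then ren id Suc P else Var (i - 1))" for k P
    by auto
  show "subst M P k = psub (\<lambda>i. if i < k then Var i else if i = k then P else Var (i - 1)) id (\<lambda>_. []) M"
    "substE E P k = psubE (\<lambda>i. if i < k then Var i else if i = k then P else Var (i - 1)) id (\<lambda>_. []) E"
    by (induction M and E arbitrary: k P and k P rule: trm.induct elim.induct)
      (simp_all add: * ** upr_id upc_Nil map_comp_Nil lift0 clift0)
qed

lemma csubst_conv_psub_gen:
  "csubst M F k = psub Var id (\<lambda>a. if a = k then [F] else []) M"
  "csubstE E F k = psubE Var id (\<lambda>a. if a = k then [F] else []) E"
proof -
  have *: "upc (\<lambda>a. if a = k then [F] else []) = (\<lambda>a. if a = Suc k then [renE id Suc F] else [])" for k F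
    by (auto simp: upc_def fun_eq_iff split: nat.split)
  have **: "map (renE Suc id) \<circ> (\<lambda>a. if a = k then [F] else [])
      = (\<lambda>a. if a = k then [renE Suc id F] else [])" for k F
    by auto
  show "csubst M F k = psub Var id (\<lambda>a. if a = k then [F] else []) M"
    "csubstE E F k = psubE Var id (\<lambda>a. if a = k then [F] else []) E"
    by (induction M and E arbitrary: k F and k F rule: trm.induct elim.induct)
      (simp_all add: * ** upr_id upi_Var ren_comp_Var lift0 clift0)
qed

lemma subst_conv_psub: "subst M P 0 = psub (case_nat P Var) id (\<lambda>_. []) M"
  unfolding subst_conv_psub_gen
  by (rule arg_cong[where f = "\<lambda>\<sigma>. psub \<sigma> id (\<lambda>_. []) M"]) (auto simp: fun_eq_iff split: nat.split)

text \<open>The cumulative effect of a run of \<open>mu\<close> steps on the body of a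
  \<open>Mu\<close>. The entries of \<open>S\<close> live inside the binder, so an outer stack is
  passed as \<open>map (cliftE 0) S\<close>.\<close>

definition csubsts :: "trm \<Rightarrow> elim list \<Rightarrow> trm" where
  "csubsts M S = psub Var id (case_nat S (\<lambda>_. [])) M"

lemma csubst_conv_csubsts: "csubst M F 0 = csubsts M [F]"
  unfolding csubst_conv_psub_gen csubsts_def
  by (rule arg_cong[where f = "\<lambda>\<tau>. psub Var id \<tau> M"]) (auto simp: fun_eq_iff split: nat.split)

lemma subst_ren [simp]:
  "subst (ren Suc id M) P 0 = M"
  "map (\<lambda>E. substE E P 0) (map (renE Suc id) S) = S"
proof -
  have *: "(\<lambda>i. if i < 0 then Var i else if i = 0 then P else Var (i - 1)) \<circ> Suc = Var"
    by auto
  show "subst (ren Suc id M) P 0 = M"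
    "map (\<lambda>E. substE E P 0) (map (renE Suc id) S) = S"
    unfolding subst_conv_psub_gen psub_ren map_map comp_def[of "psubE _ _ _"] * by (simp_all add: psub_id comp_def)
qed

lemma substE_ren [simp]: "substE (renE Suc id E) P 0 = E"
  using subst_ren(2)[where S = "[E]"] by simp

lemma subst_apps [simp]: "subst (apps M S) P k = apps (subst M P k) (map (\<lambda>E. substE E P k) S)"
  by (induction S arbitrary: M) auto

lemma psub_case_nat_upi:
  "psub (case_nat P \<sigma>') \<rho>' \<tau>' \<circ> upi \<sigma> = case_nat P (psub \<sigma>' \<rho>' \<tau>' \<circ> \<sigma>)"
  by (auto simp: upi_def fun_eq_iff psub_ren comp_def split: nat.split)

text \<open>Opening a substituted binder amounts to extending \<open>\<sigma>\<close> at index 0,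
  which is the form that an induction hypothesis for the body covers.\<close>

lemma subst_psub_upi:
  "subst (psub (upi \<sigma>) \<rho> (map (renE Suc id) \<circ> \<tau>) M) P 0 = psub (case_nat P \<sigma>) \<rho> \<tau> M"
  unfolding subst_conv_psub psub_psub psub_case_nat_upi
  by (simp add: psub_ren psub_id comp_def)

lemma psub_subst:
  "psub \<sigma> \<rho> \<tau> (subst M P 0)
     = subst (psub (upi \<sigma>) \<rho> (map (renE Suc id) \<circ> \<tau>) M) (psub \<sigma> \<rho> \<tau> P) 0"
proof -
  have *: "psub \<sigma> \<rho> \<tau> \<circ> case_nat P Var = case_nat (psub \<sigma> \<rho> \<tau> P) \<sigma>"
    by (auto simp: fun_eq_iff split: nat.split)
  have "psub \<sigma> \<rho> \<tau> (subst M P 0) = psub (case_nat (psub \<sigma> \<rho> \<tau> P) \<sigma>) \<rho> \<tau> M"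
    unfolding subst_conv_psub psub_psub * by simp
  then show ?thesis
    by (simp add: subst_psub_upi)
qed

lemma psub_case_nat_ren [simp]:
  "psub Var id (case_nat S (\<lambda>_. [])) (ren id Suc M) = ren id Suc M"
  "psubE Var id (case_nat S (\<lambda>_. [])) (renE id Suc E) = renE id Suc E"
  unfolding psub_ren by (simp_all add: ren_conv_psub comp_def)

lemma psub_comp_Var: "psub \<sigma> \<rho> \<tau> \<circ> Var = \<sigma>"
  by auto

text \<open>Neither the shifted \<open>\<sigma>\<close> nor the stacks of \<open>upc \<tau>\<close>
  contain the classical variable 0, and \<open>upc \<tau> 0\<close> is empty. Hence the two
  substitutions do not interfere, except that the entries of \<open>S\<close> are themselves
  substituted.\<close>

lemma psub_csubsts:
  "psub (ren id Suc \<circ> \<sigma>) (upr \<rho>) (upc \<tau>) (csubsts M S)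
     = csubsts (psub (ren id Suc \<circ> \<sigma>) (upr \<rho>) (upc \<tau>) M)
         (map (psubE (ren id Suc \<circ> \<sigma>) (upr \<rho>) (upc \<tau>)) S)"
proof -
  have "psub Var id (case_nat S' (\<lambda>_. [])) \<circ> (ren id Suc \<circ> \<sigma>) = ren id Suc \<circ> \<sigma>" for S'
    by (auto simp: fun_eq_iff)
  moreover have "(\<lambda>a. map (psubE (ren id Suc \<circ> \<sigma>) (upr \<rho>) (upc \<tau>)) (case_nat S (\<lambda>_. []) a) @ upc \<tau> (id a))
    = (\<lambda>a. map (psubE Var id (case_nat (map (psubE (ren id Suc \<circ> \<sigma>) (upr \<rho>) (upc \<tau>)) S) (\<lambda>_. []))) (upc \<tau> a)
        @ case_nat (map (psubE (ren id Suc \<circ> \<sigma>) (upr \<rho>) (upc \<tau>)) S) (\<lambda>_. []) (upr \<rho> a))"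
    by (auto simp: fun_eq_iff upc_def upr_def split: nat.split)
  ultimately show ?thesis
    unfolding csubsts_def psub_psub by (simp add: comp_assoc psub_comp_Var)
qed

text \<open>\<open>cliftE 0 E\<close> has no occurrence of the classical variable 0, so the second
  substitution leaves it unchanged and appends \<open>S\<close> behind it. Thus a \<open>mu\<close>
  step does not change the body into which the whole stack has been substituted.\<close>

lemma csubsts_csubst:
  "csubsts (csubst M (cliftE 0 E) 0) (map (cliftE 0) S) = csubsts M (map (cliftE 0) (E # S))"
proof -
  have "(\<lambda>a. map (psubE Var id (case_nat (map (renE id Suc) S) (\<lambda>_. [])))
            (case a of 0 \<Rightarrow> [renE id Suc E] | Suc uu_ \<Rightarrow> []) @
           (case id a of 0 \<Rightarrow> map (renE id Suc) S | Suc uu_ \<Rightarrow> []))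
     = case_nat (map (renE id Suc) (E # S)) (\<lambda>_. [])"
    by (auto simp: fun_eq_iff split: nat.split)
  then show ?thesis
    unfolding csubst_conv_csubsts csubsts_def psub_psub clift0 by (simp add: psub_comp_Var)
qed

subsection \<open>Reduction under substitution and along a stack\<close>

lemma red_apps: "M \<rhd> M' \<Longrightarrow> apps M S \<rhd> apps M' S"
  by (induction S arbitrary: M M') (simp_all add: red_redE.appL)

lemma psubE_upi_renE: "psubE (upi \<sigma>) \<rho> (map (renE Suc id) \<circ> \<tau>) (renE Suc id E) = renE Suc id (psubE \<sigma> \<rho> \<tau> E)"
  by (simp add: psub_ren ren_psub comp_def upi_def)

lemma psubE_upc_renE:
  "psubE (ren id Suc \<circ> \<sigma>) (upr \<rho>) (upc \<tau>) (renE id Suc E) = renE id Suc (psubE \<sigma> \<rho> \<tau> E)"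
  by (simp add: psub_ren ren_psub comp_def upc_def upr_def)

text \<open>Every redex survives substitution, and one step is mirrored by exactly one step; this is
  why strong normalization can be pulled back along any substitution.\<close>

lemma red_psub:
  "M \<rhd> M' \<Longrightarrow> psub \<sigma> \<rho> \<tau> M \<rhd> psub \<sigma> \<rho> \<tau> M'"
  "E \<rhd>\<^sub>E E' \<Longrightarrow> psubE \<sigma> \<rho> \<tau> E \<rhd>\<^sub>E psubE \<sigma> \<rho> \<tau> E'"
proof (induction M M' and E E' arbitrary: \<sigma> \<rho> \<tau> and \<sigma> \<rho> \<tau> rule: red_redE.inducts)
  case (beta M N) then show ?case by (simp add: psub_subst red_redE.beta)
next
  case (case1 M N1 N2) then show ?case by (simp add: psub_subst red_redE.case1)
next
  case (case2 M N1 N2) then show ?case by (simp add: psub_subst red_redE.case2)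
next
  case (perm M N1 N2 E)
  then show ?case
    using red_redE.perm[of "psub \<sigma> \<rho> \<tau> M" _ _ "psubE \<sigma> \<rho> \<tau> E"] by (simp add: lift0 psubE_upi_renE)
next
  case (mu M E)
  then show ?case
    using red_redE.mu[of _ "psubE \<sigma> \<rho> \<tau> E"]
    by (simp add: csubst_conv_csubsts psub_csubsts clift0 psubE_upc_renE)
next
  case (cvar M M' a) then show ?case by (simp add: red_redE.cvar red_apps)
qed (auto intro: red_redE.intros)

text \<open>Steps of a stack that are possible whatever term stands in front of it. A permutation of
  two adjacent entries is such a step and shortens the stack by one.\<close>

inductive redS :: "elim list \<Rightarrow> elim list \<Rightarrow> bool" where
  redS_hd: "E \<rhd>\<^sub>E E' \<Longrightarrow> redS (E # S) (E' # S)"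
| redS_tl: "redS S S' \<Longrightarrow> redS (E # S) (E # S')"
| redS_perm: "redS (Case N1 N2 # E # S) (Case (App N1 (liftE 0 E)) (App N2 (liftE 0 E)) # S)"

inductive_cases redS_ConsE: "redS (E # S) S'"

lemma redS_apps: "redS S S' \<Longrightarrow> apps M S \<rhd> apps M S'"
  by (induction arbitrary: M rule: redS.induct) (auto intro: red_apps red_redE.intros)

lemma redS_append: "redS S S' \<Longrightarrow> redS (S0 @ S) (S0 @ S')"
  by (induction S0) (auto intro: redS.intros)

lemma redS_psubE: "redS S S' \<Longrightarrow> redS (map (psubE \<sigma> \<rho> \<tau>) S) (map (psubE \<sigma> \<rho> \<tau>) S')"
  by (induction rule: redS.induct)
    (auto simp: lift0 psubE_upi_renE intro: redS.intros red_psub, simp flip: lift0 add: redS_perm)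

lemma redS_renE: "redS S S' \<Longrightarrow> redS (map (renE r s) S) (map (renE r s) S')"
  unfolding ren_conv_psub by (rule redS_psubE)

inductive root :: "trm \<Rightarrow> elim \<Rightarrow> trm \<Rightarrow> bool" where
  "root (Lam M) (Arg N) (subst M N 0)"
| "root (Pair M1 M2) Proj1 M1"
| "root (Pair M1 M2) Proj2 M2"
| "root (Inj1 M) (Case N1 N2) (subst N1 M 0)"
| "root (Inj2 M) (Case N1 N2) (subst N2 M 0)"
| "root (App M (Case N1 N2)) E (App M (Case (App N1 (liftE 0 E)) (App N2 (liftE 0 E))))"
| "root (Mu M) E (Mu (csubst M (cliftE 0 E) 0))"

inductive_cases red_AppE: "App M E \<rhd> T"
inductive_cases red_VarE: "Var i \<rhd> T"
inductive_cases red_LamE: "Lam M \<rhd> T"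
inductive_cases red_PairE: "Pair M N \<rhd> T"
inductive_cases red_Inj1E: "Inj1 M \<rhd> T"
inductive_cases red_Inj2E: "Inj2 M \<rhd> T"
inductive_cases red_MuE: "Mu M \<rhd> T"
inductive_cases red_CVarE: "CVar a M \<rhd> T"
inductive_cases redE_ArgE: "Arg M \<rhd>\<^sub>E T"
inductive_cases redE_CaseE: "Case M N \<rhd>\<^sub>E T"
inductive_cases redE_Proj1E: "Proj1 \<rhd>\<^sub>E T"
inductive_cases redE_Proj2E: "Proj2 \<rhd>\<^sub>E T"

lemma red_App_cases:
  assumes "App M E \<rhd> T"
  obtains (left) M' where "M \<rhd> M'" "T = App M' E"
  | (right) E' where "E \<rhd>\<^sub>E E'" "T = App M E'"
  | (root) "root M E T"
  using assms by (cases rule: red_AppE) (auto intro: root.intros)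

lemma red_apps_cases:
  assumes "apps M S \<rhd> T"
  obtains (head) M' where "M \<rhd> M'" "T = apps M' S"
  | (stack) S' where "redS S S'" "T = apps M S'"
  | (root) E S' T' where "S = E # S'" "root M E T'" "T = apps T' S'"
proof -
  have "(\<exists>M'. M \<rhd> M' \<and> T = apps M' S) \<or> (\<exists>S'. redS S S' \<and> T = apps M S')
    \<or> (\<exists>E S' T'. S = E # S' \<and> root M E T' \<and> T = apps T' S')"
    using assms
  proof (induction S arbitrary: M)
    case (Cons E S)
    from Cons.prems have "apps (App M E) S \<rhd> T" by simp
    from Cons.IH[OF this] consider
        (head) M' where "App M E \<rhd> M'" "T = apps M' S"
      | (stack) S' where "redS S S'" "T = apps (App M E) S'"
      | (root) F S' T' where "S = F # S'" "root (App M E) F T'" "T = apps T' S'"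
      by blast
    then show ?case
    proof cases
      case head
      from head(1) show ?thesis
        by (cases rule: red_App_cases) (use head(2) in \<open>auto intro: redS_hd\<close>)
    next
      case stack
      then show ?thesis
        by (metis apps_simps(2) redS_tl)
    next
      case root
      \<comment> \<open>A root step with head \<open>App M E\<close> can only be a permutation, so
        \<open>E\<close> is a case elimination and the step takes place within the stack.\<close>
      from root(2) show ?thesis
        by cases (use root in \<open>auto intro!: exI[of _ "Case _ _ # _"] redS_perm\<close>)
    qed
  qed auto
  then show ?thesis
    using that by blast
qed

section \<open>Many-step reduction in contexts and under substitution\<close>

lemma rtranclp_map:
  assumes "r\<^sup>*\<^sup>* x y" "\<And>x y. r x y \<Longrightarrow> s (f x) (f y)"
  shows "s\<^sup>*\<^sup>* (f x) (f y)"
  using assms(1) by induction (auto intro: assms(2) rtranclp.rtrancl_into_rtrancl)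

lemma reds_apps:
  assumes "(\<rhd>)\<^sup>*\<^sup>* M M'" "redS\<^sup>*\<^sup>* S S'"
  shows "(\<rhd>)\<^sup>*\<^sup>* (apps M S) (apps M' S')"
proof -
  have "(\<rhd>)\<^sup>*\<^sup>* (apps M S) (apps M' S)"
    using assms(1) by (rule rtranclp_map[where f = "\<lambda>M. apps M S"]) (rule red_apps)
  also have "(\<rhd>)\<^sup>*\<^sup>* (apps M' S) (apps M' S')"
    using assms(2) by (rule rtranclp_map) (rule redS_apps)
  finally show ?thesis .
qed

lemma redEs_Arg: "(\<rhd>)\<^sup>*\<^sup>* M M' \<Longrightarrow> (\<rhd>\<^sub>E)\<^sup>*\<^sup>* (Arg M) (Arg M')"
  by (erule rtranclp_map) (rule arg)

lemma reds_Pair: "(\<rhd>)\<^sup>*\<^sup>* M M' \<Longrightarrow> (\<rhd>)\<^sup>*\<^sup>* N N' \<Longrightarrow> (\<rhd>)\<^sup>*\<^sup>* (Pair M N) (Pair M' N')"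
  by (rule rtranclp_trans[of _ _ "Pair M' N"]; erule rtranclp_map) (auto intro: red_redE.intros)

lemma redEs_Case:
  "(\<rhd>)\<^sup>*\<^sup>* M M' \<Longrightarrow> (\<rhd>)\<^sup>*\<^sup>* N N' \<Longrightarrow> (\<rhd>\<^sub>E)\<^sup>*\<^sup>* (Case M N) (Case M' N')"
  by (rule rtranclp_trans[of _ _ "Case M' N"]; erule rtranclp_map) (auto intro: red_redE.intros)

lemma reds_App:
  "(\<rhd>)\<^sup>*\<^sup>* M M' \<Longrightarrow> (\<rhd>\<^sub>E)\<^sup>*\<^sup>* E E' \<Longrightarrow> (\<rhd>)\<^sup>*\<^sup>* (App M E) (App M' E')"
  by (rule rtranclp_trans[of _ _ "App M' E"]; erule rtranclp_map) (auto intro: red_redE.intros)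

lemma red_ren: "M \<rhd> M' \<Longrightarrow> ren r s M \<rhd> ren r s M'"
  unfolding ren_conv_psub by (rule red_psub)

text \<open>A substituted term or stack may be copied or erased, so a single step in it can become
  any number of steps in the result.\<close>

lemma reds_psub:
  "\<forall>i. (\<rhd>)\<^sup>*\<^sup>* (\<sigma> i) (\<sigma>' i) \<Longrightarrow> \<forall>a. redS\<^sup>*\<^sup>* (\<tau> a) (\<tau>' a) \<Longrightarrow>
    (\<rhd>)\<^sup>*\<^sup>* (psub \<sigma> \<rho> \<tau> M) (psub \<sigma>' \<rho> \<tau>' M)"
  "\<forall>i. (\<rhd>)\<^sup>*\<^sup>* (\<sigma> i) (\<sigma>' i) \<Longrightarrow> \<forall>a. redS\<^sup>*\<^sup>* (\<tau> a) (\<tau>' a) \<Longrightarrow>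
    (\<rhd>\<^sub>E)\<^sup>*\<^sup>* (psubE \<sigma> \<rho> \<tau> E) (psubE \<sigma>' \<rho> \<tau>' E)"
proof (induction M and E arbitrary: \<sigma> \<sigma>' \<rho> \<tau> \<tau>' and \<sigma> \<sigma>' \<rho> \<tau> \<tau>' rule: trm.induct elim.induct)
  have ren: "(\<rhd>)\<^sup>*\<^sup>* (ren r s M) (ren r s M')" if "(\<rhd>)\<^sup>*\<^sup>* M M'" for r s M M'
    using that by (rule rtranclp_map) (rule red_ren)
  have renS: "redS\<^sup>*\<^sup>* (map (renE r s) S) (map (renE r s) S')" if "redS\<^sup>*\<^sup>* S S'" for r s S S'
    using that by (rule rtranclp_map) (rule redS_renE)
  have upi: "\<forall>i. (\<rhd>)\<^sup>*\<^sup>* (upi \<sigma> i) (upi \<sigma>' i)" if "\<forall>i. (\<rhd>)\<^sup>*\<^sup>* (\<sigma> i) (\<sigma>' i)" for \<sigma> \<sigma>'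
    using that ren by (simp add: upi_def split: nat.split)
  have upc: "\<forall>a. redS\<^sup>*\<^sup>* (upc \<tau> a) (upc \<tau>' a)" if "\<forall>a. redS\<^sup>*\<^sup>* (\<tau> a) (\<tau>' a)" for \<tau> \<tau>'
    using that renS by (simp add: upc_def split: nat.split)
  {
    case (Lam M)
    have "(\<rhd>)\<^sup>*\<^sup>* (psub (upi \<sigma>) \<rho> (map (renE Suc id) \<circ> \<tau>) M) (psub (upi \<sigma>') \<rho> (map (renE Suc id) \<circ> \<tau>') M)"
      by (rule Lam.IH) (use Lam.prems upi renS in simp_all)
    then show ?case
      unfolding psub.simps by (rule rtranclp_map) (rule lam)
  next
    case (Mu M)
    have "(\<rhd>)\<^sup>*\<^sup>* (psub (ren id Suc \<circ> \<sigma>) (upr \<rho>) (upc \<tau>) M) (psub (ren id Suc \<circ> \<sigma>') (upr \<rho>) (upc \<tau>') M)"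
      by (rule Mu.IH) (use Mu.prems upc ren in simp_all)
    then show ?case
      unfolding psub.simps by (rule rtranclp_map) (rule muC)
  next
    case (CVar a M)
    have "(\<rhd>)\<^sup>*\<^sup>* (apps (psub \<sigma> \<rho> \<tau> M) (\<tau> a)) (apps (psub \<sigma>' \<rho> \<tau>' M) (\<tau>' a))"
      using CVar by (simp add: reds_apps)
    then show ?case
      unfolding psub.simps by (rule rtranclp_map) (rule cvar)
  next
    case (Inj1 M)
    show ?case
      unfolding psub.simps by (rule rtranclp_map[OF Inj1.IH]) (use Inj1.prems in \<open>auto intro: inj1\<close>)
  next
    case (Inj2 M)
    show ?case
      unfolding psub.simps by (rule rtranclp_map[OF Inj2.IH]) (use Inj2.prems in \<open>auto intro: inj2\<close>)
  next
    case (Case M N)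
    show ?case
      unfolding psubE.simps by (intro redEs_Case Case.IH) (use Case.prems upi renS in simp_all)
  }
qed (simp_all add: reds_Pair reds_App redEs_Arg)

lemma reds_subst: "M \<rhd> M' \<Longrightarrow> (\<rhd>)\<^sup>*\<^sup>* (subst N M 0) (subst N M' 0)"
  unfolding subst_conv_psub by (rule reds_psub) (auto split: nat.split)

lemma red_subst: "M \<rhd> M' \<Longrightarrow> subst M N 0 \<rhd> subst M' N 0"
  unfolding subst_conv_psub by (rule red_psub)

lemma reds_csubsts: "redS S S' \<Longrightarrow> (\<rhd>)\<^sup>*\<^sup>* (csubsts M S) (csubsts M S')"
  unfolding csubsts_def by (rule reds_psub) (auto split: nat.split)

lemma red_csubsts: "M \<rhd> M' \<Longrightarrow> csubsts M S \<rhd> csubsts M' S"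
  unfolding csubsts_def by (rule red_psub)

subsection \<open>Strong normalization and head expansion\<close>

lemma SN_step: "M \<in> SN \<Longrightarrow> M \<rhd> M' \<Longrightarrow> M' \<in> SN"
proof -
  assume M: "M \<in> SN" "M \<rhd> M'"
  have False if "f 0 = M'" "\<forall>n. f n \<rhd> f (Suc n)" for f
  proof -
    have "case_nat M f 0 = M \<and> (\<forall>n. case_nat M f n \<rhd> case_nat M f (Suc n))"
      using that M(2) by (auto split: nat.split)
    then show False
      using M(1) unfolding SN_def by blast
  qed
  then show "M' \<in> SN"
    unfolding SN_def by blast
qed

lemma SN_I:
  assumes "\<And>M'. M \<rhd> M' \<Longrightarrow> M' \<in> SN"
  shows "M \<in> SN"
proof -
  have False if f: "f 0 = M" "\<forall>n. f n \<rhd> f (Suc n)" for f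
  proof -
    have "f (Suc 0) \<in> SN"
      using f assms by metis
    moreover have "f (Suc 0) \<notin> SN"
      unfolding SN_def using f(2) by (auto intro!: exI[of _ "\<lambda>n. f (Suc n)"])
    ultimately show False by blast
  qed
  then show ?thesis
    unfolding SN_def by blast
qed

lemma wf_red_SN: "wf {(N, M). M \<in> SN \<and> M \<rhd> N}"
  unfolding wf_iff_no_infinite_down_chain
proof
  assume "\<exists>f. \<forall>i. (f (Suc i), f i) \<in> {(N, M). M \<in> SN \<and> M \<rhd> N}"
  then obtain f where f: "f i \<in> SN" "f i \<rhd> f (Suc i)" for i
    by auto
  from f(1)[of 0] f(2) show False
    unfolding SN_def by blast
qed

text \<open>The number \<open>n\<close> handles permutation steps, which may leave the tracked term unchanged.\<close>
lemma SN_len_induct [consumes 1, case_names step]: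
  assumes "M \<in> SN"
    and step: "\<And>M n. M \<in> SN \<Longrightarrow>
      (\<And>M' m. (\<rhd>)\<^sup>+\<^sup>+ M M' \<or> M' = M \<and> m < n \<Longrightarrow> P M' m) \<Longrightarrow> P M n"
  shows "P M (n :: nat)"
proof -
  let ?W = "{(N, M). M \<in> SN \<and> M \<rhd> N}"
  have trancl: "(N, M) \<in> ?W\<^sup>+ \<and> N \<in> SN" if "(\<rhd>)\<^sup>+\<^sup>+ M N" "M \<in> SN" for M N
    using that by induction (auto intro: SN_step trancl_into_trancl2)
  have "wf (?W\<^sup>+ <*lex*> less_than)"
    by (intro wf_lex_prod wf_trancl wf_red_SN wf_less_than)
  then have "\<forall>M n. x = (M, n) \<longrightarrow> M \<in> SN \<longrightarrow> P M n" for x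
  proof (induction x rule: wf_induct_rule)
    case (less x)
    show ?case
    proof (intro allI impI)
      fix M n assume x: "x = (M, n)" and M: "M \<in> SN"
      show "P M n"
      proof (rule step[OF M])
        fix M' m assume "(\<rhd>)\<^sup>+\<^sup>+ M M' \<or> M' = M \<and> m < n"
        then have "((M', m), x) \<in> ?W\<^sup>+ <*lex*> less_than" "M' \<in> SN"
          using trancl[of M M'] M x by auto
        then show "P M' m"
          using less.IH by blast
      qed
    qed
  qed
  then show ?thesis
    using assms(1) by blast
qed

lemma SN_induct [consumes 1, case_names step]:
  assumes "M \<in> SN" "\<And>M. M \<in> SN \<Longrightarrow> (\<And>N. (\<rhd>)\<^sup>+\<^sup>+ M N \<Longrightarrow> P N) \<Longrightarrow> P M"
  shows "P M"
  using assms(1) by (induction M "0 :: nat" rule: SN_len_induct) (rule assms(2), auto)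

text \<open>An infinite reduction of \<open>M\<close> would be mapped to one of \<open>f M\<close>.
  The maps in question are contexts and substitutions.\<close>

lemma SN_reflect:
  assumes "f M \<in> SN" "\<And>M N. M \<rhd> N \<Longrightarrow> f M \<rhd> f N"
  shows "M \<in> SN"
  using assms(1)
proof (induction "f M" arbitrary: M rule: SN_induct)
  case step
  show ?case
    by (rule SN_I) (use step.hyps(2)[OF tranclp.r_into_trancl, OF assms(2)] in blast)
qed

lemma SN_psub: "psub \<sigma> \<rho> \<tau> M \<in> SN \<Longrightarrow> M \<in> SN"
  by (erule SN_reflect) (rule red_psub)

lemma SN_Var: "Var i \<in> SN"
  by (rule SN_I) (auto elim: red_VarE)

text \<open>Intended for constructors that form no redex with their argument.\<close>

lemma SN_cong:
  assumes "M \<in> SN" "\<And>M T. f M \<rhd> T \<Longrightarrow> \<exists>M'. M \<rhd> M' \<and> T = f M'"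
  shows "f M \<in> SN"
  using assms(1)
proof (induction M rule: SN_induct)
  case (step M)
  show ?case
    by (rule SN_I) (use assms(2) step.IH[OF tranclp.r_into_trancl] in blast)
qed

lemma SN_Lam: "M \<in> SN \<Longrightarrow> Lam M \<in> SN"
  by (erule SN_cong) (blast elim: red_LamE)

lemma SN_Inj1: "M \<in> SN \<Longrightarrow> Inj1 M \<in> SN"
  by (erule SN_cong) (blast elim: red_Inj1E)

lemma SN_Inj2: "M \<in> SN \<Longrightarrow> Inj2 M \<in> SN"
  by (erule SN_cong) (blast elim: red_Inj2E)

lemma SN_CVar: "M \<in> SN \<Longrightarrow> CVar a M \<in> SN"
  by (erule SN_cong) (blast elim: red_CVarE)

text \<open>Also supplies termination measures: a pair has no root step, so a pair of strongly
  normalizing terms acts as a product of two well-founded orders on which the later inductions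
  run.\<close>

lemma SN_Pair: "M \<in> SN \<Longrightarrow> N \<in> SN \<Longrightarrow> Pair M N \<in> SN"
proof (induction M arbitrary: N rule: SN_induct)
  case (step M)
  note M = step.IH[OF tranclp.r_into_trancl]
  from \<open>N \<in> SN\<close> show ?case
  proof (induction N rule: SN_induct)
    case (step N)
    note N = step.IH[OF tranclp.r_into_trancl] and SN = step.hyps
    show ?case
    proof (rule SN_I)
      fix T assume "Pair M N \<rhd> T"
      then show "T \<in> SN"
        by (rule red_PairE) (simp_all add: M N SN)
    qed
  qed
qed

lemma SN_PairD:
  assumes "Pair M N \<in> SN"
  shows "M \<in> SN" "N \<in> SN"
  by (rule SN_reflect[of "\<lambda>M. Pair M N", OF assms pairL], assumption)
    (rule SN_reflect[of "\<lambda>N. Pair M N", OF assms pairR], assumption)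

text \<open>A decrease of the product measure: one component decreases strictly while the other
  takes any number of steps, possibly none.\<close>

lemma redp_Pair1:
  assumes "(\<rhd>)\<^sup>+\<^sup>+ M M'" "(\<rhd>)\<^sup>*\<^sup>* N N'"
  shows "(\<rhd>)\<^sup>+\<^sup>+ (Pair M N) (Pair M' N')"
proof -
  obtain L where "M \<rhd> L" "(\<rhd>)\<^sup>*\<^sup>* L M'"
    using assms(1) by (meson tranclpD)
  then show ?thesis
    using rtranclp_into_tranclp2[OF pairL reds_Pair[OF _ assms(2)]] by blast
qed

lemma redp_Pair2:
  assumes "(\<rhd>)\<^sup>*\<^sup>* M M'" "(\<rhd>)\<^sup>+\<^sup>+ N N'"
  shows "(\<rhd>)\<^sup>+\<^sup>+ (Pair M N) (Pair M' N')"
proof -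
  obtain L where "N \<rhd> L" "(\<rhd>)\<^sup>*\<^sup>* L N'"
    using assms(2) by (meson tranclpD)
  then show ?thesis
    using rtranclp_into_tranclp2[OF pairR reds_Pair[OF assms(1)]] by blast
qed

section \<open>Head expansion against a stack\<close>

lemma redS_liftE: "redS S S' \<Longrightarrow> redS (map (liftE 0) S) (map (liftE 0) S')"
  unfolding lift0 by (rule redS_renE)

lemma redS_cliftE: "redS S S' \<Longrightarrow> redS (map (cliftE 0) S) (map (cliftE 0) S')"
  unfolding clift0 by (rule redS_renE)

lemma red_apps_Cons_cases:
  assumes "apps M (E # S) \<rhd> T"
  obtains (head) M' where "M \<rhd> M'" "T = apps M' (E # S)"
  | (elim) E' where "E \<rhd>\<^sub>E E'" "T = apps M (E' # S)"
  | (stack) S' where "redS S S'" "T = apps M (E # S')"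
  | (perm) N1 N2 F S' where "E = Case N1 N2" "S = F # S'"
      "T = apps M (Case (App N1 (liftE 0 F)) (App N2 (liftE 0 F)) # S')"
  | (root) T' where "root M E T'" "T = apps T' S"
  using assms
proof (cases rule: red_apps_cases)
  case (stack S')
  from stack(1) show ?thesis
    by (cases rule: redS_ConsE) (use stack(2) that in blast)+
qed (use that in auto)

text \<open>Steps in \<open>M\<close> or \<open>S\<close> are visible in the contractum. A step in
  \<open>N\<close> vanishes there if the bound variable does not occur in \<open>M\<close>, so
  \<open>N\<close> is a separate component of the measure.\<close>

lemma SN_apps_Lam:
  assumes "N \<in> SN" "apps (subst M N 0) S \<in> SN"
  shows "apps (Lam M) (Arg N # S) \<in> SN"
proof -
  from SN_Pair[OF assms] show ?thesis
  proof (induction "Pair N (apps (subst M N 0) S)" arbitrary: M N S rule: SN_induct)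
    case (step M N S)
    note IH = step.hyps(2)
    show ?case
    proof (rule SN_I)
      fix T assume "apps (Lam M) (Arg N # S) \<rhd> T"
      then show "T \<in> SN"
      proof (cases rule: red_apps_Cons_cases)
        case (head L)
        from head(1) obtain M' where L: "L = Lam M'" "M \<rhd> M'" by (rule red_LamE)
        show ?thesis
          unfolding head(2) L(1)
          by (intro IH redp_Pair2 rtranclp.rtrancl_refl tranclp.r_into_trancl red_apps red_subst L(2))
      next
        case (elim E')
        from elim(1) obtain N' where N': "E' = Arg N'" "N \<rhd> N'" by (rule redE_ArgE)
        show ?thesis
          unfolding elim(2) N'(1)
          by (intro IH redp_Pair1 rtranclp.rtrancl_refl tranclp.r_into_trancl reds_apps reds_subst N'(2))
      next
        case (stack S')
        show ?thesis
          unfolding stack(2)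
          by (intro IH redp_Pair2 rtranclp.rtrancl_refl tranclp.r_into_trancl redS_apps stack(1))
      next
        case (root T')
        from root(1) show ?thesis
          by cases (use root(2) SN_PairD(2)[OF step.hyps(1)] in simp)
      qed simp_all
    qed
  qed
qed

text \<open>The contractum forgets \<open>N\<close>, so \<open>N\<close> enters the measure
  separately.\<close>

lemma SN_apps_Proj1:
  assumes "N \<in> SN" "apps M S \<in> SN"
  shows "apps (Pair M N) (Proj1 # S) \<in> SN"
proof -
  from SN_Pair[OF assms] show ?thesis
  proof (induction "Pair N (apps M S)" arbitrary: M N S rule: SN_induct)
    case (step M N S)
    note IH = step.hyps(2)
    show ?case
    proof (rule SN_I)
      fix T assume "apps (Pair M N) (Proj1 # S) \<rhd> T"
      then show "T \<in> SN"
      proof (cases rule: red_apps_Cons_cases)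
        case (head L)
        from head(1) consider
            (1) M' where "L = Pair M' N" "M \<rhd> M'"
          | (2) N' where "L = Pair M N'" "N \<rhd> N'"
          by (rule red_PairE)
        then show ?thesis
        proof cases
          case 1
          show ?thesis
            unfolding head(2) 1(1)
            by (intro IH redp_Pair2 rtranclp.rtrancl_refl tranclp.r_into_trancl red_apps 1(2))
        next
          case 2
          show ?thesis
            unfolding head(2) 2(1)
            by (intro IH redp_Pair1 rtranclp.rtrancl_refl tranclp.r_into_trancl 2(2))
        qed
      next
        case (elim E')
        from elim(1) show ?thesis by (rule redE_Proj1E)
      next
        case (stack S')
        show ?thesis
          unfolding stack(2)
          by (intro IH redp_Pair2 rtranclp.rtrancl_refl tranclp.r_into_trancl redS_apps stack(1))
      next
        case (root T')
        from root(1) show ?thesis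
          by cases (use root(2) SN_PairD(2)[OF step.hyps(1)] in simp)
      qed simp_all
    qed
  qed
qed

lemma SN_apps_Proj2:
  assumes "M \<in> SN" "apps N S \<in> SN"
  shows "apps (Pair M N) (Proj2 # S) \<in> SN"
proof -
  from SN_Pair[OF assms] show ?thesis
  proof (induction "Pair M (apps N S)" arbitrary: M N S rule: SN_induct)
    case (step M N S)
    note IH = step.hyps(2)
    show ?case
    proof (rule SN_I)
      fix T assume "apps (Pair M N) (Proj2 # S) \<rhd> T"
      then show "T \<in> SN"
      proof (cases rule: red_apps_Cons_cases)
        case (head L)
        from head(1) consider
            (1) M' where "L = Pair M' N" "M \<rhd> M'"
          | (2) N' where "L = Pair M N'" "N \<rhd> N'"
          by (rule red_PairE)
        then show ?thesis
        proof cases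
          case 1
          show ?thesis
            unfolding head(2) 1(1)
            by (intro IH redp_Pair1 rtranclp.rtrancl_refl tranclp.r_into_trancl 1(2))
        next
          case 2
          show ?thesis
            unfolding head(2) 2(1)
            by (intro IH redp_Pair2 rtranclp.rtrancl_refl tranclp.r_into_trancl red_apps 2(2))
        qed
      next
        case (elim E')
        from elim(1) show ?thesis by (rule redE_Proj2E)
      next
        case (stack S')
        show ?thesis
          unfolding stack(2)
          by (intro IH redp_Pair2 rtranclp.rtrancl_refl tranclp.r_into_trancl redS_apps stack(1))
      next
        case (root T')
        from root(1) show ?thesis
          by cases (use root(2) SN_PairD(2)[OF step.hyps(1)] in simp)
      qed simp_all
    qed
  qed
qed

text \<open>The measure consists of \<open>M\<close>, the discarded branch and the contractum. The
  discarded branch is tested against the shifted stack because permutations can push entries of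
  \<open>S\<close> into it.\<close>

lemma SN_apps_Inj1:
  assumes "M \<in> SN" "apps N2 (map (liftE 0) S) \<in> SN" "apps (subst N1 M 0) S \<in> SN"
  shows "apps (Inj1 M) (Case N1 N2 # S) \<in> SN"
proof -
  from SN_Pair[OF SN_Pair[OF assms(1,2)] assms(3)] show ?thesis
  proof (induction "Pair (Pair M (apps N2 (map (liftE 0) S))) (apps (subst N1 M 0) S)" "length S"
      arbitrary: M N1 N2 S rule: SN_len_induct)
    case (step M N1 N2 S)
    note IH = step.hyps(2)[OF disjI1] and IHlen = step.hyps(2)[OF disjI2]
    show ?case
    proof (rule SN_I)
      fix T assume "apps (Inj1 M) (Case N1 N2 # S) \<rhd> T"
      then show "T \<in> SN"
      proof (cases rule: red_apps_Cons_cases)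
        case (head L)
        from head(1) obtain M' where L: "L = Inj1 M'" "M \<rhd> M'" by (rule red_Inj1E)
        show ?thesis
          unfolding head(2) L(1)
          by (intro IH redp_Pair1 rtranclp.rtrancl_refl tranclp.r_into_trancl reds_apps reds_subst L(2))
      next
        case (elim E')
        from elim(1) consider
            (1) N1' where "E' = Case N1' N2" "N1 \<rhd> N1'"
          | (2) N2' where "E' = Case N1 N2'" "N2 \<rhd> N2'"
          by (rule redE_CaseE)
        then show ?thesis
        proof cases
          case 1
          show ?thesis
            unfolding elim(2) 1(1)
            by (intro IH redp_Pair2 rtranclp.rtrancl_refl tranclp.r_into_trancl red_apps red_subst 1(2))
        next
          case 2
          show ?thesis
            unfolding elim(2) 2(1)
            by (intro IH redp_Pair1[OF redp_Pair2] rtranclp.rtrancl_refl tranclp.r_into_trancl red_apps 2(2))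
        qed
      next
        case (stack S')
        show ?thesis
          unfolding stack(2)
          by (intro IH redp_Pair2 reds_Pair reds_apps r_into_rtranclp rtranclp.rtrancl_refl
              tranclp.r_into_trancl redS_apps redS_liftE stack(1))
      next
        \<comment> \<open>Moving \<open>F\<close> into the branches leaves all three tested terms
          syntactically unchanged, since the substitution undoes the shift of \<open>F\<close>; only
          the length of the stack drops.\<close>
        case (perm L1 L2 F S')
        then show ?thesis
          by (simp del: apps_simps(2)) (intro IHlen, simp add: lift0)
      next
        case (root T')
        from root(1) show ?thesis
          by cases (use root(2) SN_PairD(2)[OF step.hyps(1)] in simp)
      qed
    qed
  qed
qed

lemma SN_apps_Inj2:
  assumes "M \<in> SN" "apps N1 (map (liftE 0) S) \<in> SN" "apps (subst N2 M 0) S \<in> SN"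
  shows "apps (Inj2 M) (Case N1 N2 # S) \<in> SN"
proof -
  from SN_Pair[OF SN_Pair[OF assms(1,2)] assms(3)] show ?thesis
  proof (induction "Pair (Pair M (apps N1 (map (liftE 0) S))) (apps (subst N2 M 0) S)" "length S"
      arbitrary: M N1 N2 S rule: SN_len_induct)
    case (step M N1 N2 S)
    note IH = step.hyps(2)[OF disjI1] and IHlen = step.hyps(2)[OF disjI2]
    show ?case
    proof (rule SN_I)
      fix T assume "apps (Inj2 M) (Case N1 N2 # S) \<rhd> T"
      then show "T \<in> SN"
      proof (cases rule: red_apps_Cons_cases)
        case (head L)
        from head(1) obtain M' where L: "L = Inj2 M'" "M \<rhd> M'" by (rule red_Inj2E)
        show ?thesis
          unfolding head(2) L(1)
          by (intro IH redp_Pair1 rtranclp.rtrancl_refl tranclp.r_into_trancl reds_apps reds_subst L(2))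
      next
        case (elim E')
        from elim(1) consider
            (1) N1' where "E' = Case N1' N2" "N1 \<rhd> N1'"
          | (2) N2' where "E' = Case N1 N2'" "N2 \<rhd> N2'"
          by (rule redE_CaseE)
        then show ?thesis
        proof cases
          case 1
          show ?thesis
            unfolding elim(2) 1(1)
            by (intro IH redp_Pair1[OF redp_Pair2] rtranclp.rtrancl_refl tranclp.r_into_trancl red_apps 1(2))
        next
          case 2
          show ?thesis
            unfolding elim(2) 2(1)
            by (intro IH redp_Pair2 rtranclp.rtrancl_refl tranclp.r_into_trancl red_apps red_subst 2(2))
        qed
      next
        case (stack S')
        show ?thesis
          unfolding stack(2)
          by (intro IH redp_Pair2 reds_Pair reds_apps r_into_rtranclp rtranclp.rtrancl_refl
              tranclp.r_into_trancl redS_apps redS_liftE stack(1))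
      next
        case (perm L1 L2 F S')
        then show ?thesis
          by (simp del: apps_simps(2)) (intro IHlen, simp add: lift0)
      next
        case (root T')
        from root(1) show ?thesis
          by cases (use root(2) SN_PairD(2)[OF step.hyps(1)] in simp)
      qed
    qed
  qed
qed

text \<open>A variable never selects a branch, so both branches are tested against the shifted
  stack; a permutation preserves both tests and shortens the stack.\<close>

lemma SN_apps_Var_Case:
  assumes "apps N1 (map (liftE 0) S) \<in> SN" "apps N2 (map (liftE 0) S) \<in> SN"
  shows "apps (Var i) (Case N1 N2 # S) \<in> SN"
proof -
  from SN_Pair[OF assms] show ?thesis
  proof (induction "Pair (apps N1 (map (liftE 0) S)) (apps N2 (map (liftE 0) S))" "length S"
      arbitrary: N1 N2 S rule: SN_len_induct)
    case (step N1 N2 S)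
    note IH = step.hyps(2)[OF disjI1] and IHlen = step.hyps(2)[OF disjI2]
    show ?case
    proof (rule SN_I)
      fix T assume "apps (Var i) (Case N1 N2 # S) \<rhd> T"
      then show "T \<in> SN"
      proof (cases rule: red_apps_Cons_cases)
        case (head L)
        from head(1) show ?thesis by (rule red_VarE)
      next
        case (elim E')
        from elim(1) consider
            (1) N1' where "E' = Case N1' N2" "N1 \<rhd> N1'"
          | (2) N2' where "E' = Case N1 N2'" "N2 \<rhd> N2'"
          by (rule redE_CaseE)
        then show ?thesis
        proof cases
          case 1
          show ?thesis
            unfolding elim(2) 1(1)
            by (intro IH redp_Pair1 rtranclp.rtrancl_refl tranclp.r_into_trancl red_apps 1(2))
        next
          case 2
          show ?thesis
            unfolding elim(2) 2(1)
            by (intro IH redp_Pair2 rtranclp.rtrancl_refl tranclp.r_into_trancl red_apps 2(2))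
        qed
      next
        case (stack S')
        show ?thesis
          unfolding stack(2)
          by (intro IH redp_Pair2 reds_Pair reds_apps r_into_rtranclp rtranclp.rtrancl_refl
              tranclp.r_into_trancl redS_apps redS_liftE stack(1))
      next
        case (perm L1 L2 F S')
        then show ?thesis
          by (simp del: apps_simps(2)) (intro IHlen, simp)
      next
        case (root T')
        from root(1) show ?thesis by cases
      qed
    qed
  qed
qed

lemma SN_apps_Var_Arg:
  assumes "N \<in> SN" "apps (Var i) S \<in> SN"
  shows "apps (Var i) (Arg N # S) \<in> SN"
proof -
  from SN_Pair[OF assms] show ?thesis
  proof (induction "Pair N (apps (Var i) S)" arbitrary: N S rule: SN_induct)
    case (step N S)
    note IH = step.hyps(2)
    show ?case
    proof (rule SN_I)
      fix T assume "apps (Var i) (Arg N # S) \<rhd> T"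
      then show "T \<in> SN"
      proof (cases rule: red_apps_Cons_cases)
        case (head L)
        from head(1) show ?thesis by (rule red_VarE)
      next
        case (elim E')
        from elim(1) obtain N' where N': "E' = Arg N'" "N \<rhd> N'" by (rule redE_ArgE)
        show ?thesis
          unfolding elim(2) N'(1)
          by (intro IH redp_Pair1 rtranclp.rtrancl_refl tranclp.r_into_trancl N'(2))
      next
        case (stack S')
        show ?thesis
          unfolding stack(2)
          by (intro IH redp_Pair2 rtranclp.rtrancl_refl tranclp.r_into_trancl redS_apps stack(1))
      next
        case (root T')
        from root(1) show ?thesis by cases
      qed simp_all
    qed
  qed
qed

lemma SN_apps_Var_Proj:
  assumes "apps (Var i) S \<in> SN" "P = Proj1 \<or> P = Proj2"
  shows "apps (Var i) (P # S) \<in> SN"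
  using assms(1)
proof (induction "apps (Var i) S" arbitrary: S rule: SN_induct)
  case (step S)
  note IH = step.hyps(2)
  show ?case
  proof (rule SN_I)
    fix T assume "apps (Var i) (P # S) \<rhd> T"
    then show "T \<in> SN"
    proof (cases rule: red_apps_Cons_cases)
      case (head L)
      from head(1) show ?thesis by (rule red_VarE)
    next
      case (elim E')
      from elim(1) assms(2) show ?thesis by (blast elim: redE_Proj1E redE_Proj2E)
    next
      case (stack S')
      show ?thesis
        unfolding stack(2)
        by (intro IH tranclp.r_into_trancl redS_apps stack(1))
    next
      case (root T')
      from root(1) show ?thesis by cases
    qed (use assms(2) in simp_all)
  qed
qed

text \<open>Steps of \<open>S\<close> are lost in \<open>csubsts\<close> if the bound variable does
  not occur in \<open>M\<close>; the term \<open>apps (Var 0) (S0 @ S)\<close> keeps them visible.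
  The prefix \<open>S0\<close> collects the entries already consumed by \<open>mu\<close> steps, so
  that this term stays fixed while \<open>S\<close> gets shorter.\<close>

lemma SN_apps_Mu_append:
  assumes "csubsts M (map (cliftE 0) S) \<in> SN" "apps (Var 0) (S0 @ S) \<in> SN"
  shows "apps (Mu M) S \<in> SN"
proof -
  from SN_Pair[OF assms] show ?thesis
  proof (induction "Pair (csubsts M (map (cliftE 0) S)) (apps (Var 0) (S0 @ S))" "length S"
      arbitrary: M S S0 rule: SN_len_induct)
    case (step M S S0)
    note IH = step.hyps(2)[OF disjI1] and IHlen = step.hyps(2)[OF disjI2]
    show ?case
    proof (rule SN_I)
      fix T assume "apps (Mu M) S \<rhd> T"
      then show "T \<in> SN"
      proof (cases rule: red_apps_cases)
        case (head L)
        from head(1) obtain M' where L: "L = Mu M'" "M \<rhd> M'" by (rule red_MuE)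
        show ?thesis
          unfolding head(2) L(1)
          by (rule IH[of M' S S0], rule redp_Pair1)
            (intro rtranclp.rtrancl_refl tranclp.r_into_trancl red_csubsts L(2))+
      next
        case (stack S')
        show ?thesis
          unfolding stack(2)
          by (rule IH[of M S' S0], rule redp_Pair2)
            (intro rtranclp.rtrancl_refl tranclp.r_into_trancl reds_csubsts redS_apps redS_cliftE redS_append stack(1))+
      next
        case (root E S' T')
        from root(2) have "T' = Mu (csubst M (cliftE 0 E) 0)" by cases
        \<comment> \<open>The consumed entry moves to the end of the prefix. By
          \<open>csubsts_csubst\<close> both components of the measure are unchanged, and the length
          decreases.\<close>
        then show ?thesis
          unfolding root(3)
          using IHlen[of "csubst M (cliftE 0 E) 0" S' "S0 @ [E]"] root(1) by (simp add: csubsts_csubst)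
      qed
    qed
  qed
qed

lemmas SN_apps_Mu = SN_apps_Mu_append[where ?S0.0 = "[]", simplified append_Nil]

subsection \<open>Candidates\<close>

definition orth :: "elim list set \<Rightarrow> trm set" where
  "orth K = {M. \<forall>S\<in>K. apps M S \<in> SN}"

text \<open>The empty stack occurs in every clause so that candidates contain only strongly
  normalizing terms. In the clause for \<open>Or\<close> the rest \<open>S\<close> is tied to no
  formula, which keeps the recursion structural although the result type of a case elimination is
  arbitrary.\<close>

primrec stk :: "form \<Rightarrow> elim list set" where
  "stk (Atom n) = {[]}"
| "stk Bot = {[]}"
| "stk (Imp A B) = insert [] {Arg N # S | N S. N \<in> orth (stk A) \<and> S \<in> stk B}"
| "stk (And A B) = insert [] (Cons Proj1 ` stk A \<union> Cons Proj2 ` stk B)"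
| "stk (Or A B) = insert [] {Case N1 N2 # S | N1 N2 S.
     (\<forall>M\<in>orth (stk A). apps (subst N1 M 0) S \<in> SN) \<and>
     (\<forall>M\<in>orth (stk B). apps (subst N2 M 0) S \<in> SN)}"

lemma orthD: "M \<in> orth K \<Longrightarrow> S \<in> K \<Longrightarrow> apps M S \<in> SN"
  by (simp add: orth_def)

lemma Nil_stk: "[] \<in> stk A"
  by (cases A) auto

lemma orth_SN: "M \<in> orth (stk A) \<Longrightarrow> M \<in> SN"
  using orthD[OF _ Nil_stk] by fastforce

text \<open>Instantiating the bound variable turns the shifted stack back into \<open>S\<close>, and
  strong normalization is reflected by substitution.\<close>

lemma SN_apps_liftE:
  assumes "apps (subst N M 0) S \<in> SN"
  shows "apps N (map (liftE 0) S) \<in> SN"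
proof (rule SN_psub)
  have "subst (apps N (map (liftE 0) S)) M 0 = apps (subst N M 0) S"
    using subst_ren(2)[of M S] by (simp add: lift0 comp_def)
  then show "psub (case_nat M Var) id (\<lambda>_. []) (apps N (map (liftE 0) S)) \<in> SN"
    using assms by (simp only: subst_conv_psub)
qed

section \<open>Membership in the candidates\<close>

lemma orth_ImpI:
  assumes "M \<in> SN" "\<And>N S. N \<in> orth (stk A) \<Longrightarrow> S \<in> stk B \<Longrightarrow> apps M (Arg N # S) \<in> SN"
  shows "M \<in> orth (stk (Imp A B))"
  unfolding orth_def[of "stk (Imp A B)"] using assms by (auto simp del: apps_simps(2))

lemma orth_AndI:
  assumes "M \<in> SN" "\<And>S. S \<in> stk A \<Longrightarrow> apps M (Proj1 # S) \<in> SN" "\<And>S. S \<in> stk B \<Longrightarrow> apps M (Proj2 # S) \<in> SN"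
  shows "M \<in> orth (stk (And A B))"
  unfolding orth_def[of "stk (And A B)"] using assms by (auto simp del: apps_simps(2))

lemma orth_OrI:
  assumes "M \<in> SN"
    "\<And>N1 N2 S. (\<And>P. P \<in> orth (stk A) \<Longrightarrow> apps (subst N1 P 0) S \<in> SN) \<Longrightarrow>
      (\<And>P. P \<in> orth (stk B) \<Longrightarrow> apps (subst N2 P 0) S \<in> SN) \<Longrightarrow> apps M (Case N1 N2 # S) \<in> SN"
  shows "M \<in> orth (stk (Or A B))"
  unfolding orth_def[of "stk (Or A B)"] using assms by (auto simp del: apps_simps(2))

lemma Var_orth: "Var i \<in> orth (stk A)"
proof (induction A arbitrary: i)
  case (Imp A B)
  then show ?case
    by (intro orth_ImpI SN_Var SN_apps_Var_Arg) (rule orth_SN orthD, assumption+)+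
next
  case (And A B)
  then show ?case
    by (intro orth_AndI SN_Var SN_apps_Var_Proj) (auto intro: orthD)
next
  case (Or A B)
  \<comment> \<open>By the induction hypotheses both branches may be instantiated with
    \<open>Var 0\<close>, which gives their strong normalization against the shifted stack.\<close>
  then show ?case
    by (intro orth_OrI SN_Var SN_apps_Var_Case) (auto intro: SN_apps_liftE[of _ "Var 0"])
qed (auto simp: orth_def SN_Var)

text \<open>With an inert variable as head this expresses that the stack itself is strongly
  normalizing, the side condition of \<open>SN_apps_Mu\<close>.\<close>

lemma stk_SN: "S \<in> stk A \<Longrightarrow> apps (Var i) S \<in> SN"
  using Var_orth by (rule orthD)

lemma orth_Lam:
  assumes "\<And>N. N \<in> orth (stk A) \<Longrightarrow> subst M N 0 \<in> orth (stk B)"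
  shows "Lam M \<in> orth (stk (Imp A B))"
proof -
  \<comment> \<open>The instance at a variable yields \<open>M \<in> SN\<close> by reflection, which
    settles the empty stack.\<close>
  have "subst M (Var 0) 0 \<in> SN"
    by (intro orth_SN[of _ B] assms Var_orth)
  then have "M \<in> SN"
    unfolding subst_conv_psub by (rule SN_psub)
  then show ?thesis
    by (intro orth_ImpI SN_Lam SN_apps_Lam orthD[OF assms]) (simp_all add: orth_SN)
qed

lemma orth_Pair: "M \<in> orth (stk A) \<Longrightarrow> N \<in> orth (stk B) \<Longrightarrow> Pair M N \<in> orth (stk (And A B))"
  by (intro orth_AndI SN_apps_Proj1 SN_apps_Proj2 SN_Pair) (simp_all add: orth_SN orthD)

lemma orth_Inj1: "M \<in> orth (stk A) \<Longrightarrow> Inj1 M \<in> orth (stk (Or A B))"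
  by (intro orth_OrI SN_Inj1 SN_apps_Inj1) (auto intro: orth_SN SN_apps_liftE[of _ "Var 0"] Var_orth)

lemma orth_Inj2: "M \<in> orth (stk B) \<Longrightarrow> Inj2 M \<in> orth (stk (Or A B))"
  by (intro orth_OrI SN_Inj2 SN_apps_Inj2) (auto intro: orth_SN SN_apps_liftE[of _ "Var 0"] Var_orth)

lemma orth_App:
  assumes "M \<in> orth (stk A)" "\<And>S. S \<in> stk B \<Longrightarrow> E # S \<in> stk A"
  shows "App M E \<in> orth (stk B)"
  using assms by (auto simp: orth_def simp flip: apps_simps(2))

text \<open>Renaming the bound variable of \<open>Mu\<close> to an arbitrary \<open>b\<close> undoes the shift of \<open>\<sigma>\<close> and \<open>\<tau>\<close>,
  so the candidates need not be closed under shifting.\<close>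
lemma ren_csubsts_psub:
  "ren id (case_nat b id) (csubsts (psub (ren id Suc \<circ> \<sigma>) (upr \<rho>) (upc \<tau>) M) (map (cliftE 0) S))
     = psub \<sigma> (case_nat b \<rho>) (case_nat S \<tau>) M"
proof -
  have ren: "ren id (case_nat b id) (ren id Suc P) = P" "renE id (case_nat b id) (renE id Suc E) = E" for P E
    unfolding ren_ren by (simp_all add: comp_def ren_conv_psub)
  have "ren id (case_nat b id) \<circ> (psub Var id (case_nat (map (cliftE 0) S) (\<lambda>_. [])) \<circ> (ren id Suc \<circ> \<sigma>)) = \<sigma>"
    by (simp add: fun_eq_iff ren)
  moreover have "case_nat b id \<circ> (id \<circ> upr \<rho>) = case_nat b \<rho>"
    by (auto simp: fun_eq_iff upr_def split: nat.split)
  moreover have "map (renE id (case_nat b id)) \<circ>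
      (\<lambda>a. map (psubE Var id (case_nat (map (cliftE 0) S) (\<lambda>_. []))) (upc \<tau> a)
        @ case_nat (map (cliftE 0) S) (\<lambda>_. []) (upr \<rho> a)) = case_nat S \<tau>"
    by (auto simp: fun_eq_iff upr_def upc_def clift0 ren comp_def split: nat.split)
  ultimately show ?thesis
    unfolding csubsts_def psub_psub ren_psub by simp
qed

text \<open>A declaration \<open>a : \<not>B\<close> is interpreted by a stack for \<open>B\<close>.
  The renaming \<open>\<rho>\<close> is arbitrary, as candidates put no condition on the names of
  classical variables; the case of \<open>Mu\<close> relies on this freedom.\<close>

lemma adequacy:
  assumes "\<Gamma>; \<Delta> \<turnstile> M : A"
    and "\<And>i. i < length \<Gamma> \<Longrightarrow> \<sigma> i \<in> orth (stk (\<Gamma> ! i))"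
    and "\<And>a. a < length \<Delta> \<Longrightarrow> \<tau> a \<in> stk (\<Delta> ! a)"
  shows "psub \<sigma> \<rho> \<tau> M \<in> orth (stk A)"
  using assms
proof (induction arbitrary: \<sigma> \<rho> \<tau> rule: typing.induct)
  case (ty_var i \<Gamma> \<Delta>)
  then show ?case by simp
next
  case (ty_pair \<Gamma> \<Delta> M A N B)
  show ?case unfolding psub.simps by (rule orth_Pair) (use ty_pair in \<open>simp_all del: stk.simps\<close>)
next
  case (ty_proj1 \<Gamma> \<Delta> M A B)
  show ?case
    unfolding psub.simps psubE.simps
    by (rule orth_App[OF ty_proj1.IH[OF ty_proj1.prems]]) simp_all
next
  case (ty_proj2 \<Gamma> \<Delta> M A B)
  show ?case
    unfolding psub.simps psubE.simps
    by (rule orth_App[OF ty_proj2.IH[OF ty_proj2.prems]]) simp_all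
next
  case (ty_lam A \<Gamma> \<Delta> M B)
  show ?case
    unfolding psub.simps
  proof (rule orth_Lam)
    fix N assume "N \<in> orth (stk A)"
    then show "subst (psub (upi \<sigma>) \<rho> (map (renE Suc id) \<circ> \<tau>) M) N 0 \<in> orth (stk B)"
      unfolding subst_psub_upi using ty_lam.prems
      by (intro ty_lam.IH) (auto simp: nth_Cons split: nat.split)
  qed
next
  case (ty_app \<Gamma> \<Delta> M A B N)
  have "psub \<sigma> \<rho> \<tau> N \<in> orth (stk A)"
    using ty_app.prems by (rule ty_app.IH(2))
  then show ?case
    unfolding psub.simps psubE.simps
    by (intro orth_App[OF ty_app.IH(1)[OF ty_app.prems]]) simp_all
next
  case (ty_inj1 \<Gamma> \<Delta> M A B)
  show ?case unfolding psub.simps by (rule orth_Inj1) (use ty_inj1 in \<open>simp_all del: stk.simps\<close>)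
next
  case (ty_inj2 \<Gamma> \<Delta> M B A)
  show ?case unfolding psub.simps by (rule orth_Inj2) (use ty_inj2 in \<open>simp_all del: stk.simps\<close>)
next
  case (ty_case \<Gamma> \<Delta> M A B N1 C N2)
  have N1: "psub (case_nat P \<sigma>) \<rho> \<tau> N1 \<in> orth (stk C)" if "P \<in> orth (stk A)" for P
    using that ty_case.prems by (intro ty_case.IH(2)) (auto simp: nth_Cons split: nat.split)
  have N2: "psub (case_nat P \<sigma>) \<rho> \<tau> N2 \<in> orth (stk C)" if "P \<in> orth (stk B)" for P
    using that ty_case.prems by (intro ty_case.IH(3)) (auto simp: nth_Cons split: nat.split)
  have M: "psub \<sigma> \<rho> \<tau> M \<in> orth (stk (Or A B))"
    using ty_case.prems by (rule ty_case.IH(1))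
  \<comment> \<open>A stack for \<open>C\<close> serves as the rest in the clause for
    \<open>Or\<close>, because both instantiated branches lie in the candidate of
    \<open>C\<close>.\<close>
  show ?case
    unfolding psub.simps psubE.simps
    by (rule orth_App[OF M]) (auto simp: subst_psub_upi intro!: orthD[OF N1] orthD[OF N2])
next
  case (ty_mu \<Gamma> A \<Delta> M)
  show ?case
    unfolding psub.simps orth_def
  proof (intro CollectI ballI)
    fix S assume S: "S \<in> stk A"
    let ?M = "psub (ren id Suc \<circ> \<sigma>) (upr \<rho>) (upc \<tau>) M"
    \<comment> \<open>Sending the bound variable to 0 may identify it with another classical
      variable. This is harmless, since strong normalization is reflected even by non-injective
      renamings.\<close>
    have "ren id (case_nat 0 id) (csubsts ?M (map (cliftE 0) S)) \<in> orth (stk Bot)"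
      unfolding ren_csubsts_psub using ty_mu.prems S
      by (intro ty_mu.IH) (auto simp: nth_Cons split: nat.split)
    then have "csubsts ?M (map (cliftE 0) S) \<in> SN"
      unfolding ren_conv_psub by (rule SN_psub[OF orth_SN])
    then show "apps (Mu ?M) S \<in> SN"
      by (rule SN_apps_Mu) (rule stk_SN[OF S])
  qed
next
  case (ty_cvar a \<Delta> \<Gamma> M)
  have "apps (psub \<sigma> \<rho> \<tau> M) (\<tau> a) \<in> SN"
    by (rule orthD[OF ty_cvar.IH[OF ty_cvar.prems] ty_cvar.prems(2)[OF ty_cvar.hyps(1)]])
  \<comment> \<open>Only the empty stack belongs to \<open>stk Bot\<close>, so strong normalization
    suffices at this type.\<close>
  then show ?case
    by (simp add: orth_def SN_CVar)
qed

text \<open>Adequacy for the identity substitution: variables lie in every candidate, and the empty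
  stack is a stack for every formula.\<close>

theorem strong_normalization:
  assumes "typed M"
  shows "M \<in> SN"
proof -
  from assms obtain \<Gamma> \<Delta> A where "\<Gamma>; \<Delta> \<turnstile> M : A"
    unfolding typed_def by blast
  then have "psub Var id (\<lambda>_. []) M \<in> orth (stk A)"
    by (rule adequacy) (simp_all add: Var_orth Nil_stk)
  then show ?thesis
    unfolding psub_id by (rule orth_SN)
qed

theorem theorem3p8:
  fixes N N1 N2 :: trm and \<epsilon> :: elim and V :: "elim list" and S1 S2 :: trm
  defines "S1 \<equiv> apps N (Case N1 N2 # \<epsilon> # V)"
    and "S2 \<equiv> apps N (Case (App N1 (liftE 0 \<epsilon>)) (App N2 (liftE 0 \<epsilon>)) # V)"
  assumes "nice (\<epsilon> # V)"
    and "typed S1"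
    and "typed S2"
    and "S2 \<in> SN"
  shows "S1 \<in> SN"
  using \<open>typed S1\<close> by (rule strong_normalization)

end
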